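(* Let $\mathfrak a_{n,m}$ be the number of $\sigma\in\mathcal{I}_n(110,120)$ with $\max(\sigma)=m$. Let $\mathfrak b_{n,k}=\sum_{\ell=0}^{n}|\mathcal W_{\ell,k}(110,120)|$ be the number of words of length at most $n$ over $\{0,\dots,k-1\}$ avoiding both $110$ and $120$. Then for all integers $0<m<n$, $$\mathfrak a_{n,m}=\sum_{p=m+1}^{n}\sum_{j=0}^{m-1}\mathfrak a_{p-1,j}\,\mathfrak b_{n-p,m-j}.$$
   Context: For $n\in\mathbb N$, an inversion sequence of size $n$ is a sequence $\sigma=(\sigma_1,\dots,\sigma_n)\in\mathbb N^n$ with $\sigma_i<i$ for all $i$. An integer sequence contains a pattern $\rho$ (a finite integer sequence such as $110$ or $120$) if it has a subsequence order-isomorphic to $\rho$, and avoids $\rho$ otherwise. $\mathcal{I}_n(P)$ denotes the set of inversion sequences of size $n$ avoiding every pattern in the set $P$. $\mathcal W_{n,k}=\{0,\dots,k-1\}^n$ is the set of words of length $n$ over $\{0,\dots,k-1\}$, and $\mathcal W_{n,k}(P)$ its subset of words avoiding every pattern in $P$. $\max(\sigma)$ is the largest entry of $\sigma$. *)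

theory Defs
  imports Main "HOL-Library.Sublist"
begin

definition order_isomorphic :: "'a::linorder list \<Rightarrow> 'b::linorder list \<Rightarrow> bool" where
  "order_isomorphic xs ys \<longleftrightarrow> length xs = length ys \<and>
     (\<forall>i<length xs. \<forall>j<length xs. xs ! i < xs ! j \<longleftrightarrow> ys ! i < ys ! j)"

text \<open>The library's \<open>subseq\<close> is the not necessarily contiguous subsequence relation.\<close>

definition contains_pattern :: "nat list \<Rightarrow> nat list \<Rightarrow> bool" where
  "contains_pattern xs \<rho> \<longleftrightarrow> (\<exists>ys. subseq ys xs \<and> order_isomorphic ys \<rho>)"

definition avoids_all :: "nat list \<Rightarrow> nat list set \<Rightarrow> bool" where
  "avoids_all xs P \<longleftrightarrow> (\<forall>\<rho>\<in>P. \<not> contains_pattern xs \<rho>)"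

text \<open>List positions are 0-based, so the \<open>i\<close>-th entry of a sequence, \<open>1 \<le> i \<le> n\<close>, is
  \<open>\<sigma> ! (i - 1)\<close>.\<close>

definition inv_seqs :: "nat \<Rightarrow> nat list set \<Rightarrow> nat list set" where
  "inv_seqs n P = {\<sigma>. length \<sigma> = n \<and> (\<forall>i\<in>{1..n}. \<sigma> ! (i - 1) < i) \<and> avoids_all \<sigma> P}"

definition words :: "nat \<Rightarrow> nat \<Rightarrow> nat list set \<Rightarrow> nat list set" where
  "words n k P = {w. length w = n \<and> set w \<subseteq> {0..<k} \<and> avoids_all w P}"

definition patterns_110_120 :: "nat list set" where
  "patterns_110_120 = {[1, 1, 0], [1, 2, 0]}"

text \<open>Meaningful for \<open>n \<ge> 1\<close> only: the empty sequence has no largest entry, and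
  \<open>Max {}\<close> is unspecified.\<close>

definition num_inv_seqs_max :: "nat \<Rightarrow> nat \<Rightarrow> nat" where
  "num_inv_seqs_max n m = card {\<sigma> \<in> inv_seqs n patterns_110_120. Max (set \<sigma>) = m}"

definition num_words_upto :: "nat \<Rightarrow> nat \<Rightarrow> nat" where
  "num_words_upto n k = (\<Sum>l = 0..n. card (words l k patterns_110_120))"

end

theory Submission
  imports Defs
begin

text \<open>Cut a sequence at its first maximum \<open>m\<close>, in 1-based position \<open>p\<close>, and let \<open>j\<close> be the maximum
  of the prefix before it. Avoiding both patterns means having no \<open>a, b, c\<close> in this order with
  \<open>c < a \<le> b\<close>. With the cut entry \<open>m\<close> as \<open>b\<close> this says that every entry after the cut is at least
  \<open>j\<close>; with it as \<open>a\<close>, that only \<open>m\<close> can follow a second \<open>m\<close>. So the suffix is a word over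
  \<open>{j..<m}\<close> followed by copies of \<open>m\<close>, and after a shift by \<open>j\<close> the word is arbitrary among the
  avoiding words over \<open>{0..<m - j}\<close> of length at most \<open>n - p\<close>.\<close>

section \<open>Both patterns as one condition on triples\<close>

definition good :: "nat list \<Rightarrow> bool" where
  "good xs \<longleftrightarrow> (\<forall>a b c. subseq [a, b, c] xs \<longrightarrow> c < a \<longrightarrow> b < a)"

lemma goodD: "good xs \<Longrightarrow> subseq [a, b, c] xs \<Longrightarrow> c < a \<Longrightarrow> b < a"
  by (auto simp: good_def)

lemma order_isomorphic_triple_iff:
  "order_isomorphic ys [x, y, z] \<longleftrightarrow> (\<exists>a b c. ys = [a, b, c] \<and>
    (a < b \<longleftrightarrow> x < y) \<and> (b < a \<longleftrightarrow> y < x) \<and> (a < c \<longleftrightarrow> x < z) \<and> (c < a \<longleftrightarrow> z < x) \<and>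
    (b < c \<longleftrightarrow> y < z) \<and> (c < b \<longleftrightarrow> z < y))"
proof (cases "\<exists>a b c. ys = [a, b, c]")
  case True
  then obtain a b c where "ys = [a, b, c]" by blast
  then show ?thesis by (simp add: order_isomorphic_def All_less_Suc) blast
next
  case False
  then have "length ys \<noteq> 3" by (auto simp: length_Suc_conv numeral_3_eq_3)
  with False show ?thesis by (auto simp: order_isomorphic_def)
qed

lemma order_isomorphic_110: "order_isomorphic ys [1, 1, 0 :: nat] \<longleftrightarrow> (\<exists>a c. ys = [a, a, c] \<and> c < a)"
  by (auto simp: order_isomorphic_triple_iff)

lemma order_isomorphic_120:
  "order_isomorphic ys [1, 2, 0 :: nat] \<longleftrightarrow> (\<exists>a b c. ys = [a, b, c] \<and> c < a \<and> a < b)"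
  by (auto simp: order_isomorphic_triple_iff)

text \<open>In a forbidden triple \<open>c < a \<le> b\<close>, the case \<open>a = b\<close> is 110
  and the case \<open>a < b\<close> is 120.\<close>

lemma avoids_iff_good: "avoids_all xs patterns_110_120 \<longleftrightarrow> good xs"
proof -
  have "avoids_all xs patterns_110_120 \<longleftrightarrow>
      (\<forall>a c. subseq [a, a, c] xs \<longrightarrow> \<not> c < a) \<and> (\<forall>a b c. subseq [a, b, c] xs \<longrightarrow> c < a \<longrightarrow> \<not> a < b)"
    unfolding avoids_all_def patterns_110_120_def contains_pattern_def ball_simps
      order_isomorphic_110 order_isomorphic_120
    by blast
  then show ?thesis
    unfolding good_def by (metis linorder_neqE_nat not_less_iff_gr_or_eq)
qed

section \<open>Behaviour of \<open>good\<close> under subsequences, shifts and concatenation\<close>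

lemma subseq_imp_set_subset: "subseq xs ys \<Longrightarrow> set xs \<subseteq> set ys"
  by (induction rule: list_emb.induct) auto

lemma good_subseq: "good xs \<Longrightarrow> subseq ys xs \<Longrightarrow> good ys"
  unfolding good_def by (meson subseq_order.order_trans)

lemma good_shift_iff: "good (map (\<lambda>x. x + j) w) \<longleftrightarrow> good w"
proof
  assume g: "good (map (\<lambda>x. x + j) w)"
  show "good w"
    unfolding good_def
  proof (intro allI impI)
    fix a b c assume "subseq [a, b, c] w" "c < a"
    from subseq_map[OF this(1), of "\<lambda>x. x + j"] this(2) show "b < a"
      using goodD[OF g, of "a + j" "b + j" "c + j"] by simp
  qed
next
  assume g: "good w"
  show "good (map (\<lambda>x. x + j) w)"
    unfolding good_def
  proof (intro allI impI)
    fix a b c assume s: "subseq [a, b, c] (map (\<lambda>x. x + j) w)" and "c < a"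
    \<comment> \<open>Entries of the shifted list are at least \<open>j\<close>, so truncated
      subtraction of \<open>j\<close> undoes the shift and keeps the order.\<close>
    from subseq_imp_set_subset[OF s] have "j \<le> a" "j \<le> b" "j \<le> c" by auto
    moreover have "subseq [a - j, b - j, c - j] w"
      using subseq_map[OF s, of "\<lambda>x. x - j"] by (simp add: o_def)
    ultimately show "b < a"
      using goodD[OF g, of "a - j" "b - j" "c - j"] \<open>c < a\<close> by linarith
  qed
qed

text \<open>A triple with \<open>c < a\<close> cannot start in \<open>u\<close> and end in
  \<open>v\<close>, so it lies entirely in one of the two parts.\<close>

lemma good_appendI:
  assumes "good u" "good v" "\<forall>x\<in>set u. \<forall>y\<in>set v. x \<le> y"
  shows "good (u @ v)"
  unfolding good_def
proof (intro allI impI)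
  fix a b c assume "subseq [a, b, c] (u @ v)" "c < a"
  from this(1) obtain s t where st: "[a, b, c] = s @ t" "subseq s u" "subseq t v"
    by (rule subseq_appendE)
  have "\<not> (a \<in> set s \<and> c \<in> set t)"
    using subseq_imp_set_subset[OF st(2)] subseq_imp_set_subset[OF st(3)] assms(3) \<open>c < a\<close>
    by fastforce
  then have "s = [] \<or> t = []"
    using st(1) by (auto simp: Cons_eq_append_conv)
  then show "b < a"
    using st assms(1,2) \<open>c < a\<close> goodD[of _ a b c] by auto
qed

lemma good_replicate: "good (replicate r m)"
  unfolding good_def by (auto dest!: subseq_imp_set_subset split: if_splits)

text \<open>The part after the leading \<open>m\<close> is good by concatenation. If
  \<open>a\<close> is the leading \<open>m\<close>, then \<open>c < m\<close> puts \<open>c\<close>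
  in \<open>w\<close>; so \<open>b\<close>, which precedes it, is in \<open>w\<close> too and is
  below \<open>m\<close>.\<close>

lemma good_Cons_word_replicate:
  assumes "good w" "\<forall>x\<in>set w. x < m"
  shows "good (m # w @ replicate r m)"
  unfolding good_def
proof (intro allI impI)
  have gv: "good (w @ replicate r m)"
    using assms by (intro good_appendI good_replicate) auto
  fix a b c assume *: "subseq [a, b, c] (m # w @ replicate r m)" "c < a"
  show "b < a"
  proof (cases "subseq [a, b, c] (w @ replicate r m)")
    case True
    with gv * show ?thesis by (blast dest: goodD)
  next
    case False
    with * have a: "a = m" and bc: "subseq [b, c] (w @ replicate r m)"
      by (auto split: if_splits)
    from bc obtain s t where st: "[b, c] = s @ t" "subseq s w" "subseq t (replicate r m)"
      by (rule subseq_appendE)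
    \<comment> \<open>\<open>t\<close> consists of copies of \<open>m\<close> only, and
      \<open>c < m\<close>.\<close>
    have "c \<notin> set t"
      using subseq_imp_set_subset[OF st(3)] \<open>c < a\<close> a by (auto split: if_splits)
    then have "b \<in> set s"
      using st(1) by (auto simp: Cons_eq_append_conv)
    then show ?thesis
      using subseq_imp_set_subset[OF st(2)] assms(2) a by auto
  qed
qed

text \<open>The two conclusions come from the triples \<open>x, m, y\<close> with
  \<open>y < x\<close> and \<open>m, m, x\<close> with \<open>x < m\<close>, both forbidden.\<close>

lemma good_decompose:
  assumes g: "good (u @ m # v)" and u: "\<forall>x\<in>set u. x \<le> m" and v: "\<forall>x\<in>set v. x \<le> m"
  shows "\<forall>x\<in>set u. \<forall>y\<in>set v. x \<le> y"
    and "\<exists>w r. v = w @ replicate r m \<and> m \<notin> set w"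
proof -
  show "\<forall>x\<in>set u. \<forall>y\<in>set v. x \<le> y"
  proof (intro ballI, rule ccontr)
    fix x y assume "x \<in> set u" "y \<in> set v" "\<not> x \<le> y"
    then have "subseq ([x] @ [m] @ [y]) (u @ [m] @ v)"
      by (intro list_emb_append_mono) (auto simp: subseq_singleton_left)
    then show False
      using goodD[OF g, of x m y] u \<open>x \<in> set u\<close> \<open>\<not> x \<le> y\<close> by fastforce
  qed
  show "\<exists>w r. v = w @ replicate r m \<and> m \<notin> set w"
  proof (cases "m \<in> set v")
    case False
    then show ?thesis by (intro exI[of _ v] exI[of _ 0]) auto
  next
    case True
    then obtain w t where vt: "v = w @ m # t" "m \<notin> set w"
      by (meson split_list_first)
    have "x = m" if "x \<in> set t" for x
    proof (rule ccontr)
      assume "x \<noteq> m"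
      with v vt that have "x < m" by (simp add: order.strict_iff_order)
      have "subseq ([] @ [m] @ [] @ [m] @ [x]) (u @ [m] @ w @ [m] @ t)"
        using that by (intro list_emb_append_mono) (auto simp: subseq_singleton_left)
      then show False
        using goodD[OF g, of m m x] vt \<open>x < m\<close> by simp
    qed
    then have "m # t = replicate (Suc (length t)) m"
      by (auto intro: replicate_eqI)
    with vt show ?thesis by metis
  qed
qed

section \<open>The sets being counted\<close>

lemma inv_seqs_iff: "\<sigma> \<in> inv_seqs n patterns_110_120 \<longleftrightarrow> length \<sigma> = n \<and> (\<forall>i<n. \<sigma> ! i \<le> i) \<and> good \<sigma>"
proof -
  have "(\<forall>i\<in>{1..n}. \<sigma> ! (i - 1) < i) \<longleftrightarrow> (\<forall>i<n. \<sigma> ! i \<le> i)"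
  proof -
    \<comment> \<open>Passing from 1-based to 0-based positions turns the strict bound into a weak
      one.\<close>
    have "{1..n} = Suc ` {..<n}" by (simp add: image_Suc_lessThan)
    then show ?thesis by (auto simp: less_Suc_eq_le)
  qed
  then show ?thesis by (auto simp: inv_seqs_def avoids_iff_good)
qed

lemma words_iff: "w \<in> words n k patterns_110_120 \<longleftrightarrow> length w = n \<and> (\<forall>x\<in>set w. x < k) \<and> good w"
  by (auto simp: words_def avoids_iff_good)

definition inv_seqs_max :: "nat \<Rightarrow> nat \<Rightarrow> nat list set" where
  "inv_seqs_max n m = {\<sigma> \<in> inv_seqs n patterns_110_120. Max (set \<sigma>) = m}"

definition words_upto :: "nat \<Rightarrow> nat \<Rightarrow> nat list set" where
  "words_upto n k = (\<Union>l\<in>{0..n}. words l k patterns_110_120)"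

lemma words_upto_iff:
  "w \<in> words_upto n k \<longleftrightarrow> length w \<le> n \<and> (\<forall>x\<in>set w. x < k) \<and> good w"
  by (auto simp: words_upto_def words_iff)

lemma finite_words: "finite (words l k P)"
  by (rule finite_subset[OF _ finite_lists_length_eq[of "{0..<k}" l]]) (auto simp: words_def)

lemma card_words_upto: "card (words_upto n k) = num_words_upto n k"
  unfolding words_upto_def num_words_upto_def
  by (rule card_UN_disjoint) (auto simp: finite_words, auto simp: words_def)

lemma finite_words_upto: "finite (words_upto n k)"
  by (simp add: words_upto_def finite_words)

text \<open>For a nonempty list, \<open>Max\<close> is described by membership and an upper bound;
  \<open>0 < n\<close> excludes the empty list, where \<open>Max\<close> is unspecified.\<close>

lemma inv_seqs_max_iff:
  assumes "0 < n"
  shows "\<sigma> \<in> inv_seqs_max n m \<longleftrightarrow>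
    length \<sigma> = n \<and> (\<forall>i<n. \<sigma> ! i \<le> i) \<and> good \<sigma> \<and> m \<in> set \<sigma> \<and> (\<forall>x\<in>set \<sigma>. x \<le> m)"
  using assms by (auto simp: inv_seqs_max_def inv_seqs_iff Max_eq_iff)

lemma finite_inv_seqs_max: "finite (inv_seqs_max n m)"
proof (rule finite_subset[OF _ finite_lists_length_eq[of "{..n}" n]])
  show "inv_seqs_max n m \<subseteq> {xs. set xs \<subseteq> {..n} \<and> length xs = n}"
    by (auto simp: inv_seqs_max_def inv_seqs_iff in_set_conv_nth)
      (meson less_imp_le_nat order.trans)
qed simp

section \<open>The bijection between sequences and their pieces\<close>

lemma append_Cons_first_unique:
  "u @ m # v = u' @ m # v' \<Longrightarrow> m \<notin> set u \<Longrightarrow> m \<notin> set u' \<Longrightarrow> u = u' \<and> v = v'"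
proof (induction u arbitrary: u')
  case Nil
  then show ?case by (cases u') auto
next
  case (Cons a u)
  then show ?case by (cases u') auto
qed

lemma append_replicate_unique:
  assumes "w @ replicate r m = w' @ replicate r' m" "m \<notin> set w" "m \<notin> set w'"
  shows "w = w'"
proof -
  \<comment> \<open>Deleting every \<open>m\<close> removes both final runs, whatever their lengths,
    and leaves \<open>w\<close> and \<open>w'\<close>.\<close>
  have "filter (\<lambda>x. x \<noteq> m) w = w" "filter (\<lambda>x. x \<noteq> m) w' = w'"
    using assms(2,3) by (auto intro: filter_True)
  with arg_cong[OF assms(1), of "filter (\<lambda>x. x \<noteq> m)"] show ?thesis by simp
qed

text \<open>The inverse of the cut. The number of final copies of \<open>m\<close> is what fills the
  list up to length \<open>n\<close>.\<close>

fun assemble :: "nat \<Rightarrow> nat \<Rightarrow> nat \<times> nat \<times> nat list \<times> nat list \<Rightarrow> nat list" where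
  "assemble n m (p, j, u, w) = u @ m # map (\<lambda>x. x + j) w @ replicate (n - p - length w) m"

text \<open>\<open>p\<close> and \<open>j\<close> are kept although \<open>u\<close> determines
  them: as a dependent sum, the set has the double sum as its cardinality. The range of
  \<open>p\<close> starts at \<open>m + 1\<close> because the entry \<open>m\<close> in position
  \<open>p\<close> must satisfy \<open>m < p\<close>.\<close>

definition pieces :: "nat \<Rightarrow> nat \<Rightarrow> (nat \<times> nat \<times> nat list \<times> nat list) set" where
  "pieces n m = (SIGMA p:{m + 1..n}. SIGMA j:{0..m - 1}. inv_seqs_max (p - 1) j \<times> words_upto (n - p) (m - j))"

text \<open>\<open>u\<close> is what precedes the first \<open>m\<close>; its length and maximum
  give \<open>p\<close> and \<open>j\<close>; dropping the final run of \<open>m\<close> and undoing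
  the shift gives \<open>w\<close>.\<close>

lemma inj_on_assemble:
  assumes "0 < m"
  shows "inj_on (assemble n m) (pieces n m)"
proof (rule inj_onI)
  fix s s'
  assume "s \<in> pieces n m" "s' \<in> pieces n m" "assemble n m s = assemble n m s'"
  moreover obtain p j u w where s: "s = (p, j, u, w)" by (cases s)
  moreover obtain p' j' u' w' where s': "s' = (p', j', u', w')" by (cases s')
  ultimately have a: "(p, j, u, w) \<in> pieces n m" and a': "(p', j', u', w') \<in> pieces n m"
    and eq: "assemble n m (p, j, u, w) = assemble n m (p', j', u', w')" by auto
  have *: "length u = p - 1 \<and> 0 < p \<and> Max (set u) = j \<and> m \<notin> set u \<and> m \<notin> set (map (\<lambda>x. x + j) w)"
    if "(p, j, u, w) \<in> pieces n m" for p j u w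
  proof -
    from that assms have p: "m < p" "j < m" "u \<in> inv_seqs_max (p - 1) j" "\<forall>x\<in>set w. x < m - j"
      by (auto simp: pieces_def words_upto_iff)
    then have "\<forall>x\<in>set u. x \<le> j"
      using inv_seqs_max_iff[of "p - 1" u j] assms by simp
    with p show ?thesis
      by (force simp: inv_seqs_max_def inv_seqs_iff)
  qed
  note b = *[OF a] and b' = *[OF a']
  from append_Cons_first_unique[OF eq[unfolded assemble.simps]] b b'
  have u: "u = u'"
    and v: "map (\<lambda>x. x + j) w @ replicate (n - p - length w) m =
      map (\<lambda>x. x + j') w' @ replicate (n - p' - length w') m" by auto
  from u b b' have pj: "p = p'" "j = j'" by auto
  have "map (\<lambda>x. x + j) w = map (\<lambda>x. x + j) w'"
    using append_replicate_unique[OF v] b b' pj by simp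
  then have "w = w'" by (simp add: inj_map_eq_map inj_def)
  with u pj s s' show "s = s'" by simp
qed

lemma assemble_in:
  assumes "0 < m" "(p, j, u, w) \<in> pieces n m"
  shows "assemble n m (p, j, u, w) \<in> inv_seqs_max n m"
proof -
  from assms have p: "m < p" "p \<le> n" "j < m" and u: "u \<in> inv_seqs_max (p - 1) j"
    and w: "w \<in> words_upto (n - p) (m - j)"
    by (auto simp: pieces_def)
  \<comment> \<open>The prefix is nonempty, so its maximum is meaningful.\<close>
  from p assms have "0 < p - 1" by simp
  note u = u[unfolded inv_seqs_max_iff[OF this]]
  note w = w[unfolded words_upto_iff]
  let ?v = "m # map (\<lambda>x. x + j) w @ replicate (n - p - length w) m"
  \<comment> \<open>The value \<open>j\<close> separates the parts: entries of \<open>u\<close> are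
    at most \<open>j\<close>, those of \<open>?v\<close> at least \<open>j\<close>.\<close>
  have "good (u @ ?v)"
    using u w p by (intro good_appendI good_Cons_word_replicate) (fastforce simp: good_shift_iff)+
  moreover have vm: "\<forall>x\<in>set ?v. x \<le> m" using w p by fastforce
  moreover have len: "length (u @ ?v) = n" using u w p by auto
  \<comment> \<open>Before the cut the bound is that of \<open>u\<close>; from the cut on, entries
    are at most \<open>m\<close> and indices at least \<open>p - 1 \<ge> m\<close>.\<close>
  moreover have "(u @ ?v) ! i \<le> i" if "i < n" for i
  proof (cases "i < length u")
    case True
    then show ?thesis using u by (simp add: nth_append)
  next
    case False
    then have "(u @ ?v) ! i = ?v ! (i - length u)" by (simp only: nth_append if_False)
    moreover have "?v ! (i - length u) \<in> set ?v"
      using that False len by (intro nth_mem) (simp only: length_append)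
    ultimately show ?thesis using vm False u p by fastforce
  qed
  moreover have "\<forall>x\<in>set u. x \<le> m" using u p by auto
  ultimately show ?thesis
    using p by (subst inv_seqs_max_iff) auto
qed

lemma assemble_surj:
  assumes "0 < m" "m < n" "\<sigma> \<in> inv_seqs_max n m"
  shows "\<sigma> \<in> assemble n m ` pieces n m"
proof -
  have \<sigma>: "length \<sigma> = n" "\<forall>i<n. \<sigma> ! i \<le> i" "good \<sigma>" "m \<in> set \<sigma>" "\<forall>x\<in>set \<sigma>. x \<le> m"
    using assms inv_seqs_max_iff[of n \<sigma> m] by auto
  then obtain u v where uv: "\<sigma> = u @ m # v" "m \<notin> set u"
    by (meson split_list_first)
  \<comment> \<open>The bound at the cut gives \<open>m \<le> length u\<close>. Hence
    \<open>p = length u + 1\<close> is in range, and \<open>u\<close> is nonempty because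
    \<open>0 < m\<close>.\<close>
  have "\<sigma> ! length u \<le> length u" using \<sigma>(1,2) uv(1) by (simp del: nth_append_length)
  then have mu: "m \<le> length u" using uv by simp
  then have ne: "u \<noteq> []" using assms by auto
  define j where "j = Max (set u)"
  have j: "j \<in> set u" "\<forall>x\<in>set u. x \<le> j" using ne by (auto simp: j_def)
  have jm: "j < m" using j(1) uv \<sigma>(5) by (auto simp: order.strict_iff_order)
  have "good (u @ m # v)" "\<forall>x\<in>set u. x \<le> m" "\<forall>x\<in>set v. x \<le> m"
    using \<sigma>(3,5) uv(1) by simp_all
  note dec = good_decompose[OF this]
  from dec(2) obtain w r where w: "v = w @ replicate r m" "m \<notin> set w"
    by blast
  have jw: "\<forall>x\<in>set w. j \<le> x \<and> x < m"
  proof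
    fix x assume "x \<in> set w"
    then have "x \<in> set v" "x \<noteq> m" using w by auto
    then show "j \<le> x \<and> x < m"
      using dec(1) j(1) \<open>\<forall>x\<in>set v. x \<le> m\<close> by (simp add: order.strict_iff_order)
  qed
  \<comment> \<open>All entries of \<open>w\<close> are at least \<open>j\<close>, so adding
    \<open>j\<close> back recovers \<open>w\<close>.\<close>
  define w' where "w' = map (\<lambda>x. x - j) w"
  have ww': "w = map (\<lambda>x. x + j) w'"
    using jw by (simp add: w'_def map_idI)
  have good_uw: "good u" "good w"
    using good_subseq[OF \<sigma>(3)] unfolding uv(1) w(1)
    by (simp_all add: subseq_rev_drop_many subseq_drop_many list_emb_Cons)
  then have "good w'" using good_shift_iff[of j w'] ww' by simp
  have lw: "length w' = length w" by (simp add: w'_def)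
  have len: "n = length u + 1 + length w + r" using \<sigma> uv w by simp
  have "u ! i \<le> i" if "i < length u" for i
  proof -
    from that len have "\<sigma> ! i \<le> i" using \<sigma>(2) by simp
    with that show ?thesis by (simp add: uv(1) nth_append)
  qed
  then have "u \<in> inv_seqs_max (length u) j"
    using good_uw j ne by (simp add: inv_seqs_max_iff)
  moreover have "w' \<in> words_upto (n - (length u + 1)) (m - j)"
    using jw \<open>good w'\<close> lw len by (auto simp: words_upto_iff w'_def diff_less_mono)
  ultimately have "(length u + 1, j, u, w') \<in> pieces n m"
    using jm mu len by (auto simp: pieces_def)
  \<comment> \<open>By \<open>len\<close>, the number of copies of \<open>m\<close> that
    \<open>assemble\<close> appends is exactly \<open>r\<close>.\<close>
  moreover have "\<sigma> = assemble n m (length u + 1, j, u, w')"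
    using uv w len lw by (simp add: ww'[symmetric])
  ultimately show ?thesis by blast
qed

theorem theorem14:
  fixes n m :: nat
  assumes "0 < m" and "m < n"
  shows "num_inv_seqs_max n m =
    (\<Sum>p = m + 1..n. \<Sum>j = 0..m - 1. num_inv_seqs_max (p - 1) j * num_words_upto (n - p) (m - j))"
proof -
  have "inv_seqs_max n m = assemble n m ` pieces n m"
    using assemble_in[OF assms(1)] assemble_surj[OF assms] by auto
  then have "card (inv_seqs_max n m) = card (pieces n m)"
    by (simp add: card_image inj_on_assemble assms)
  also have "\<dots> = (\<Sum>p = m + 1..n. \<Sum>j = 0..m - 1.
      card (inv_seqs_max (p - 1) j) * card (words_upto (n - p) (m - j)))"
    by (simp add: pieces_def card_SigmaI finite_inv_seqs_max finite_words_upto card_cartesian_product)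
  finally show ?thesis
    by (simp add: inv_seqs_max_def num_inv_seqs_max_def card_words_upto)
qed

end
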